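(* Let $\{P_{k,n}:0\le k\le n\}$ and $\{Q_{k,n}:0\le k\le n\}$ be polynomials related, with $z=x+iy$, as follows. Given $\{Q_{k,n}:0\le k\le n\}\subset\mathcal{V}_n^2(W,\mathbb{C})$, define $$P_{k,n}(x,y)=\tfrac{1}{\sqrt2}\big[Q_{k,n}(z,\bar z)+Q_{n-k,n}(z,\bar z)\big]\ \ (0\le k\le\tfrac n2),\qquad P_{k,n}(x,y)=\tfrac{1}{\sqrt2\, i}\big[Q_{k,n}(z,\bar z)-Q_{n-k,n}(z,\bar z)\big]\ \ (\tfrac n2<k\le n).$$ Conversely, given $\{P_{k,n}:0\le k\le n\}\subset\mathcal{V}_n^2(W)$, define $$Q_{k,n}(z,\bar z)=\tfrac1{\sqrt2}\big[P_{k,n}(x,y)-iP_{n-k,n}(x,y)\big]\ \ (0\le k<\tfrac n2),\qquad Q_{k,n}(z,\bar z)=\tfrac1{\sqrt2}\big[P_{n-k,n}(x,y)+iP_{k,n}(x,y)\big]\ \ (\tfrac n2<k\le n),$$ and $Q_{n/2,n}(z,\bar z)=\tfrac1{\sqrt2}P_{n/2,n}(x,y)$ if $n$ is even. Then: (1) $\{Q_{k,n}:0\le k\le n\}$ is a basis of $\mathcal{V}_n^2(W,\mathbb{C})$ that satisfies $Q_{k,n}(z,\bar z)=\overline{Q_{n-k,n}(z,\bar z)}$ for $0\le k\le n$ if and only if $\{P_{k,n}:0\le k\le n\}$ is a basis of $\mathcal{V}_n^2(W)$. (2) $\{Q_{k,n}:0\le k\le n\}$ is an orthonormal basis of $\mathcal{V}_n^2(W,\mathbb{C})$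 if and only if $\{P_{k,n}:0\le k\le n\}$ is an orthonormal basis of $\mathcal{V}_n^2(W)$. (3) The reproducing kernels of $\mathcal{V}_n^2(W)$ and $\mathcal{V}_n^2(W,\mathbb{C})$ agree; in particular, $$\mathbf{P}_n^{\mathbb{C}}(z,\zeta)=\mathbf{P}_n((x,y),(u,v))\quad\text{and}\quad \mathbf{K}_n^{\mathbb{C}}(z,\zeta)=\mathbf{K}_n((x,y),(u,v)),$$ where $z=x+iy$ and $\zeta=u+iv$.
   Context: Let $\Omega\subset\mathbb{R}^2$ and let $W$ be a nonnegative weight function on $\Omega$, normalized by $\int_\Omega W\,dx\,dy=1$, such that $\int_\Omega f^2W\,dx\,dy>0$ for every nonzero real polynomial $f$ in $x,y$ and such that the inner products below are well defined for all polynomials. Identify $\mathbb{R}^2$ with $\mathbb{C}$ via $z=x+iy$ and put $w(z)=W(x,y)$. $\Pi_n^2$ is the space of real polynomials in $(x,y)$ of total degree at most $n$; $\Pi_n^2(\mathbb{C})$ is the space of polynomials in $z,\bar z$ with complex coefficients of total degree at most $n$; $\Pi_{-1}^2=\Pi_{-1}^2(\mathbb{C})=\{0\}$. Inner products: $\langle f,g\rangle_W=\int_\Omega f g\,W\,dx\,dy$ for real polynomials, and $\langle f,g\rangle_W^{\mathbb{C}}=\int_\Omega f(z,\bar z)\overline{g(z,\bar z)}\,w(z)\,dx\,dy$ for polynomials in $z,\bar z$. $\mathcal{V}_n^2(W)=\{P\in\Pi_n^2:\langle P,Q\rangle_W=0\ \forall Q\in\Pi_{n-1}^2\}$ and $\mathcal{V}_n^2(W,\mathbb{C})=\{P\in\Pi_n^2(\mathbb{C}):\langle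 P,Q\rangle_W^{\mathbb{C}}=0\ \forall Q\in\Pi_{n-1}^2(\mathbb{C})\}$ are the spaces of real and complex orthogonal polynomials of degree $n$; each has dimension $n+1$ (over $\mathbb{R}$ and $\mathbb{C}$ respectively). Orthonormality is with respect to $\langle\cdot,\cdot\rangle_W$ and $\langle\cdot,\cdot\rangle_W^{\mathbb{C}}$ respectively. Reproducing kernels: for orthonormal bases $\{p_{k,m}\}_{k=0}^m$ of $\mathcal{V}_m^2(W)$ and $\{q_{k,m}\}_{k=0}^m$ of $\mathcal{V}_m^2(W,\mathbb{C})$, $m\ge 0$, put $\mathbf{P}_m((x,y),(u,v))=\sum_{k=0}^m p_{k,m}(x,y)p_{k,m}(u,v)$, $\mathbf{P}_m^{\mathbb{C}}(z,\zeta)=\sum_{k=0}^m q_{k,m}(z,\bar z)\overline{q_{k,m}(\zeta,\bar\zeta)}$, $\mathbf{K}_n=\sum_{m=0}^n\mathbf{P}_m$ and $\mathbf{K}_n^{\mathbb{C}}=\sum_{m=0}^n\mathbf{P}_m^{\mathbb{C}}$.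
   Formalization: In (2), for even n, P_{n/2,n} is divided by √2 before orthonormality is compared (as printed, P_{n/2,n}=√2 Q_{n/2,n}, so both cannot be orthonormal); when P is defined from Q, the conjugate symmetry of (1) is also required of Q, since otherwise P need not be real. *)

theory Defs
  imports "HOL-Analysis.Analysis" "HOL-Library.Function_Algebras"
begin

text \<open>Polynomials are represented by the functions they induce on the whole plane; since the plane
  is infinite in both coordinates, coefficients and total degree are determined by the function.
  Functions of \<open>(x, y)\<close> have type \<open>real \<times> real \<Rightarrow> _\<close>, functions of \<open>z\<close> (and its conjugate) have
  type \<open>complex \<Rightarrow> complex\<close>.\<close>

definition to_complex :: "real \<times> real \<Rightarrow> complex" where
  "to_complex a = Complex (fst a) (snd a)"


subsection \<open>Polynomials of bounded total degree\<close>

text \<open>The degree bound is an integer so that the bound \<open>-1\<close> gives the zero space.\<close>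

definition real_polys :: "int \<Rightarrow> (real \<times> real \<Rightarrow> real) set" where
  "real_polys d =
     {f. \<exists>c :: nat \<Rightarrow> nat \<Rightarrow> real.
           f = (\<lambda>(x, y). \<Sum>(i, j)\<in>{(i, j). int (i + j) \<le> d}. c i j * x ^ i * y ^ j)}"

definition complex_polys :: "int \<Rightarrow> (complex \<Rightarrow> complex) set" where
  "complex_polys d =
     {f. \<exists>c :: nat \<Rightarrow> nat \<Rightarrow> complex.
           f = (\<lambda>z. \<Sum>(i, j)\<in>{(i, j). int (i + j) \<le> d}. c i j * z ^ i * cnj z ^ j)}"

lemma finite_exponents: "finite {(i :: nat, j :: nat). int (i + j) \<le> d}"
  by (rule finite_subset[of _ "{..nat d} \<times> {..nat d}"]) auto

lemma real_polys_minus_one: "real_polys (- 1) = {0}"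
  by (auto simp: real_polys_def fun_eq_iff)

lemma complex_polys_minus_one: "complex_polys (- 1) = {0}"
  by (auto simp: complex_polys_def fun_eq_iff)


subsection \<open>Weights, inner products and orthogonal polynomials\<close>

text \<open>All integrals are Lebesgue integrals. Neither \<open>\<Omega>\<close> nor \<open>W\<close> is assumed measurable separately;
  integrability only concerns \<open>W\<close> restricted to \<open>\<Omega>\<close>. As products of polynomials are polynomials,
  the second clause makes both inner products below well defined.\<close>

definition admissible_weight :: "(real \<times> real) set \<Rightarrow> (real \<times> real \<Rightarrow> real) \<Rightarrow> bool" where
  "admissible_weight \<Omega> W \<longleftrightarrow>
     (\<forall>a\<in>\<Omega>. 0 \<le> W a) \<and>
     (\<forall>d. \<forall>f\<in>real_polys d. set_integrable lebesgue \<Omega> (\<lambda>a. f a * W a)) \<and>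
     (LINT a:\<Omega>|lebesgue. W a) = 1 \<and>
     (\<forall>d. \<forall>f\<in>real_polys d. f \<noteq> 0 \<longrightarrow> 0 < (LINT a:\<Omega>|lebesgue. (f a)\<^sup>2 * W a))"

definition real_inner_W ::
  "(real \<times> real) set \<Rightarrow> (real \<times> real \<Rightarrow> real) \<Rightarrow>
   (real \<times> real \<Rightarrow> real) \<Rightarrow> (real \<times> real \<Rightarrow> real) \<Rightarrow> real" where
  "real_inner_W \<Omega> W f g = (LINT a:\<Omega>|lebesgue. f a * g a * W a)"

definition complex_inner_W ::
  "(real \<times> real) set \<Rightarrow> (real \<times> real \<Rightarrow> real) \<Rightarrow>
   (complex \<Rightarrow> complex) \<Rightarrow> (complex \<Rightarrow> complex) \<Rightarrow> complex" where
  "complex_inner_W \<Omega> W f g =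
     (LINT a:\<Omega>|lebesgue. f (to_complex a) * cnj (g (to_complex a)) * complex_of_real (W a))"

definition real_OP ::
  "(real \<times> real) set \<Rightarrow> (real \<times> real \<Rightarrow> real) \<Rightarrow> nat \<Rightarrow> (real \<times> real \<Rightarrow> real) set" where
  "real_OP \<Omega> W n =
     {P \<in> real_polys (int n). \<forall>Q\<in>real_polys (int n - 1). real_inner_W \<Omega> W P Q = 0}"

definition complex_OP ::
  "(real \<times> real) set \<Rightarrow> (real \<times> real \<Rightarrow> real) \<Rightarrow> nat \<Rightarrow> (complex \<Rightarrow> complex) set" where
  "complex_OP \<Omega> W n =
     {P \<in> complex_polys (int n). \<forall>Q\<in>complex_polys (int n - 1). complex_inner_W \<Omega> W P Q = 0}"


subsection \<open>Bases\<close>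

definition fun_scale :: "'a::field \<Rightarrow> ('b \<Rightarrow> 'a) \<Rightarrow> 'b \<Rightarrow> 'a" where
  "fun_scale c f = (\<lambda>x. c * f x)"

global_interpretation fun_vs: vector_space "fun_scale :: 'a::field \<Rightarrow> ('b \<Rightarrow> 'a) \<Rightarrow> 'b \<Rightarrow> 'a"
  by unfold_locales (auto simp: fun_scale_def fun_eq_iff algebra_simps)

text \<open>The family \<open>F 0, \<dots>, F n\<close> is a basis of \<open>V\<close> over the field in which the functions take their
  values. Values \<open>F k\<close> with \<open>k > n\<close> are irrelevant, here and below.\<close>

definition basis_family :: "nat \<Rightarrow> (nat \<Rightarrow> 'b \<Rightarrow> 'a::field) \<Rightarrow> ('b \<Rightarrow> 'a) set \<Rightarrow> bool" where
  "basis_family n F V \<longleftrightarrow>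
     inj_on F {..n} \<and> fun_vs.independent (F ` {..n}) \<and> fun_vs.span (F ` {..n}) = V"

definition real_ONB ::
  "(real \<times> real) set \<Rightarrow> (real \<times> real \<Rightarrow> real) \<Rightarrow> nat \<Rightarrow> (nat \<Rightarrow> real \<times> real \<Rightarrow> real) \<Rightarrow> bool" where
  "real_ONB \<Omega> W n P \<longleftrightarrow>
     basis_family n P (real_OP \<Omega> W n) \<and>
     (\<forall>j\<le>n. \<forall>k\<le>n. real_inner_W \<Omega> W (P j) (P k) = (if j = k then 1 else 0))"

definition complex_ONB ::
  "(real \<times> real) set \<Rightarrow> (real \<times> real \<Rightarrow> real) \<Rightarrow> nat \<Rightarrow> (nat \<Rightarrow> complex \<Rightarrow> complex) \<Rightarrow> bool" where
  "complex_ONB \<Omega> W n Q \<longleftrightarrow>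
     basis_family n Q (complex_OP \<Omega> W n) \<and>
     (\<forall>j\<le>n. \<forall>k\<le>n. complex_inner_W \<Omega> W (Q j) (Q k) = (if j = k then 1 else 0))"

definition conj_symmetric :: "nat \<Rightarrow> (nat \<Rightarrow> complex \<Rightarrow> complex) \<Rightarrow> bool" where
  "conj_symmetric n Q \<longleftrightarrow> (\<forall>k\<le>n. \<forall>z. Q k z = cnj (Q (n - k) z))"


subsection \<open>Passing between the two families\<close>

text \<open>The family built from an arbitrary complex family need not be real valued, so both
  transformations act on complex-valued functions of \<open>(x, y)\<close>. They are inverse to each other on
  the indices \<open>k \<le> n\<close>.\<close>

definition P_of_Q :: "nat \<Rightarrow> (nat \<Rightarrow> complex \<Rightarrow> complex) \<Rightarrow> nat \<Rightarrow> real \<times> real \<Rightarrow> complex" where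
  "P_of_Q n Q k a =
     (let z = to_complex a in
      if 2 * k \<le> n then 1 / complex_of_real (sqrt 2) * (Q k z + Q (n - k) z)
      else 1 / (complex_of_real (sqrt 2) * \<i>) * (Q k z - Q (n - k) z))"

definition Q_of_P :: "nat \<Rightarrow> (nat \<Rightarrow> real \<times> real \<Rightarrow> complex) \<Rightarrow> nat \<Rightarrow> complex \<Rightarrow> complex" where
  "Q_of_P n P k z =
     (let a = (Re z, Im z) in
      if 2 * k < n then 1 / complex_of_real (sqrt 2) * (P k a - \<i> * P (n - k) a)
      else if n < 2 * k then 1 / complex_of_real (sqrt 2) * (P (n - k) a + \<i> * P k a)
      else 1 / complex_of_real (sqrt 2) * P k a)"

definition complexify :: "(nat \<Rightarrow> real \<times> real \<Rightarrow> real) \<Rightarrow> nat \<Rightarrow> real \<times> real \<Rightarrow> complex" where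
  "complexify P k a = complex_of_real (P k a)"

lemma Q_of_P_P_of_Q:
  assumes "k \<le> n"
  shows "Q_of_P n (P_of_Q n Q) k = Q k"
proof -
  have [simp]: "complex_of_real (sqrt 2) * complex_of_real (sqrt 2) = 2"
    by (simp flip: of_real_mult)
  show ?thesis
    using assms
    by (auto simp: Q_of_P_def P_of_Q_def to_complex_def Let_def fun_eq_iff field_simps)
qed

lemma P_of_Q_middle:
  assumes "2 * k = n"
  shows "P_of_Q n Q k a = complex_of_real (sqrt 2) * Q k (to_complex a)"
proof -
  have "n - k = k" using assms by simp
  moreover have "complex_of_real (sqrt 2) * complex_of_real (sqrt 2) = 2"
    by (simp flip: of_real_mult)
  ultimately show ?thesis
    using assms by (simp add: P_of_Q_def Let_def field_simps)
qed

text \<open>By the preceding lemma the norms of the members with index \<open>n/2\<close> differ by the factor \<open>\<surd>2\<close>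
  when \<open>n\<close> is even, so that \<open>Q\<close> and \<open>P\<close> are then never both orthonormal. This one member of \<open>P\<close> has
  to be divided by \<open>\<surd>2\<close> before orthonormality is compared.\<close>

definition rescale_middle :: "nat \<Rightarrow> (nat \<Rightarrow> 'b \<Rightarrow> 'a::real_vector) \<Rightarrow> nat \<Rightarrow> 'b \<Rightarrow> 'a" where
  "rescale_middle n P k a = (if 2 * k = n then (1 / sqrt 2) *\<^sub>R P k a else P k a)"

lemma rescale_middle_odd: "odd n \<Longrightarrow> rescale_middle n P = P"
  by (auto simp: rescale_middle_def fun_eq_iff)


subsection \<open>Reproducing kernels\<close>

text \<open>In \<open>p m k\<close> and \<open>q m k\<close> the first index is the degree.\<close>

definition real_P_kernel ::
  "(nat \<Rightarrow> nat \<Rightarrow> real \<times> real \<Rightarrow> real) \<Rightarrow> nat \<Rightarrow> real \<times> real \<Rightarrow> real \<times> real \<Rightarrow> real" where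
  "real_P_kernel p m a b = (\<Sum>k\<le>m. p m k a * p m k b)"

definition complex_P_kernel ::
  "(nat \<Rightarrow> nat \<Rightarrow> complex \<Rightarrow> complex) \<Rightarrow> nat \<Rightarrow> complex \<Rightarrow> complex \<Rightarrow> complex" where
  "complex_P_kernel q m z \<zeta> = (\<Sum>k\<le>m. q m k z * cnj (q m k \<zeta>))"

definition real_K_kernel ::
  "(nat \<Rightarrow> nat \<Rightarrow> real \<times> real \<Rightarrow> real) \<Rightarrow> nat \<Rightarrow> real \<times> real \<Rightarrow> real \<times> real \<Rightarrow> real" where
  "real_K_kernel p n a b = (\<Sum>m\<le>n. real_P_kernel p m a b)"

definition complex_K_kernel ::
  "(nat \<Rightarrow> nat \<Rightarrow> complex \<Rightarrow> complex) \<Rightarrow> nat \<Rightarrow> complex \<Rightarrow> complex \<Rightarrow> complex" where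
  "complex_K_kernel q n z \<zeta> = (\<Sum>m\<le>n. complex_P_kernel q m z \<zeta>)"

end

theory Submission
  imports Defs
begin

text \<open>
  The reason for all three claims is that everything complex in sight is the complexification of
  its real counterpart. A complex polynomial in \<open>z\<close> and its conjugate is the same thing as \<open>u + i v\<close>
  with real polynomials \<open>u\<close>, \<open>v\<close> of the same degree
  (\<open>complex_polys_eq_complexification\<close>), the complex inner product is the sesquilinear extension of
  the real one, and hence the complex orthogonal polynomials of degree \<open>n\<close> are exactly the
  combinations \<open>u + i v\<close> of real ones (\<open>complex_OP_eq_complexification\<close>). A real family is
  therefore a basis, or an orthonormal basis, of the real space if and only if it is one of the
  complex space when its members are read as complex-valued functions (\<open>basis_family_cplx\<close>,
  \<open>complex_ONB_cplx\<close>).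

  What is left of (1) and (2) takes place inside one complex space. Passing from \<open>P\<close>, with its middle
  member divided by \<open>\<surd>2\<close>, to \<open>Q\<close> mixes the members with indices \<open>k\<close> and \<open>n - k\<close> by a unitary
  matrix with two rows, and fixes the middle member (\<open>Q_of_P_eq_mix\<close>); so does the way back
  (\<open>cplx_P_eq_mix\<close>). Such a change preserves spans, hence bases, and it preserves orthonormality
  (\<open>complex_ONB_mix\<close>). The dilation of the middle member by \<open>\<surd>2\<close> does not affect the property of being
  a basis. Finally, the family \<open>P\<close> built from \<open>Q\<close> is real valued exactly when \<open>Q\<close> is conjugate
  symmetric (\<open>conj_symmetric_iff_real_P\<close>), and \<open>Q\<close> is recovered from \<open>P\<close>; so the claims that start from
  \<open>Q\<close> reduce to those that start from \<open>P\<close>.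

  For (3), the reproducing kernel of a complex space does not depend on the orthonormal basis
  (\<open>complex_kernel_unique\<close>), and a real orthonormal basis is one particular complex orthonormal
  basis.
\<close>


section \<open>Complexification of spaces of real functions\<close>

lemma fun_scale_apply: "fun_scale c f x = c * f x"
  by (simp add: fun_scale_def)

definition re_part :: "(complex \<Rightarrow> complex) \<Rightarrow> real \<times> real \<Rightarrow> real" where
  "re_part f a = Re (f (to_complex a))"

definition im_part :: "(complex \<Rightarrow> complex) \<Rightarrow> real \<times> real \<Rightarrow> real" where
  "im_part f a = Im (f (to_complex a))"

definition cplx :: "(real \<times> real \<Rightarrow> real) \<Rightarrow> complex \<Rightarrow> complex" where
  "cplx p z = complex_of_real (p (Re z, Im z))"

definition complexification :: "(real \<times> real \<Rightarrow> real) set \<Rightarrow> (complex \<Rightarrow> complex) set" where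
  "complexification V = {f. re_part f \<in> V \<and> im_part f \<in> V}"

lemma to_complex_Re_Im [simp]: "to_complex (Re z, Im z) = z"
  by (simp add: to_complex_def)

lemma cplx_to_complex [simp]: "cplx p (to_complex a) = complex_of_real (p a)"
  by (simp add: cplx_def to_complex_def)

text \<open>Every complex-valued function is \<open>u + i v\<close>; all transfers between the real and the complex spaces
  rest on this decomposition.\<close>

lemma cplx_re_im: "f = cplx (re_part f) + fun_scale \<i> (cplx (im_part f))"
  by (simp add: fun_scale_apply fun_eq_iff cplx_def re_part_def im_part_def complex_eq_iff)

lemma re_part_cplx [simp]: "re_part (cplx p) = p"
  and im_part_cplx [simp]: "im_part (cplx p) = 0"
  by (auto simp: fun_scale_apply fun_eq_iff re_part_def im_part_def)

lemma re_part_add [simp]: "re_part (f + g) = re_part f + re_part g"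
  and im_part_add [simp]: "im_part (f + g) = im_part f + im_part g"
  and re_part_zero [simp]: "re_part 0 = 0"
  and im_part_zero [simp]: "im_part 0 = 0"
  by (auto simp: fun_scale_apply fun_eq_iff re_part_def im_part_def)

lemma re_part_scale [simp]:
    "re_part (fun_scale c f) = fun_scale (Re c) (re_part f) + fun_scale (- Im c) (im_part f)"
  and im_part_scale [simp]:
    "im_part (fun_scale c f) = fun_scale (Re c) (im_part f) + fun_scale (Im c) (re_part f)"
  by (auto simp: fun_scale_apply fun_eq_iff re_part_def im_part_def)

lemma cplx_add: "cplx (p + q) = cplx p + cplx q"
  and cplx_scale: "cplx (fun_scale c p) = fun_scale (complex_of_real c) (cplx p)"
  and cplx_zero: "cplx 0 = 0"
  by (auto simp: fun_scale_apply fun_eq_iff cplx_def)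

lemma inj_cplx: "inj cplx"
  by (rule injI) (metis re_part_cplx)

lemma subspace_complexification:
  assumes "fun_vs.subspace V"
  shows "fun_vs.subspace (complexification V)"
  unfolding fun_vs.subspace_def complexification_def
  by (auto intro!: fun_vs.subspace_0 fun_vs.subspace_add
      fun_vs.subspace_diff fun_vs.subspace_scale assms)

lemma cplx_in_complexification:
  assumes "fun_vs.subspace V"
  shows "cplx p \<in> complexification V \<longleftrightarrow> p \<in> V"
  using fun_vs.subspace_0[OF assms] by (simp add: complexification_def)

lemma complexification_eq_iff:
  assumes "fun_vs.subspace U" "fun_vs.subspace V"
  shows "complexification U = complexification V \<longleftrightarrow> U = V"
  using cplx_in_complexification[OF assms(1)] cplx_in_complexification[OF assms(2)] by blast

text \<open>Complex spans of real functions carry no more information than real spans. The inclusion from left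
  to right holds because a complexification is a complex subspace, the other one because \<open>u\<close> and \<open>v\<close> lie
  separately in the span on the left whenever \<open>u + i v\<close> lies in the complexification.\<close>

lemma span_cplx_image: "fun_vs.span (cplx ` S) = complexification (fun_vs.span S)"
proof
  have "cplx ` S \<subseteq> complexification (fun_vs.span S)"
    by (auto simp: cplx_in_complexification fun_vs.span_base)
  then show "fun_vs.span (cplx ` S) \<subseteq> complexification (fun_vs.span S)"
    by (intro fun_vs.span_minimal subspace_complexification fun_vs.subspace_span)
next
  have cplx_span: "cplx p \<in> fun_vs.span (cplx ` S)" if "p \<in> fun_vs.span S" for p
    using that
  proof (induction rule: fun_vs.span_induct_alt)
    case base
    show ?case unfolding cplx_zero by (rule fun_vs.span_zero)
  next
    case (step c p q)
    then show ?case
      unfolding cplx_add cplx_scale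
      by (intro fun_vs.span_add fun_vs.span_scale) (auto intro: fun_vs.span_base)
  qed
  show "complexification (fun_vs.span S) \<subseteq> fun_vs.span (cplx ` S)"
  proof
    fix f assume "f \<in> complexification (fun_vs.span S)"
    then have "cplx (re_part f) + fun_scale \<i> (cplx (im_part f)) \<in> fun_vs.span (cplx ` S)"
      by (intro fun_vs.span_add fun_vs.span_scale cplx_span) (auto simp: complexification_def)
    then show "f \<in> fun_vs.span (cplx ` S)"
      using cplx_re_im[of f] by simp
  qed
qed

text \<open>Dependence says that some member lies in the span of the others, so it transfers along with
  spans.\<close>

lemma independent_cplx_image: "fun_vs.independent (cplx ` S) \<longleftrightarrow> fun_vs.independent S"
proof -
  have "cplx p \<in> fun_vs.span (cplx ` S - {cplx p}) \<longleftrightarrow> p \<in> fun_vs.span (S - {p})" for p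
  proof -
    have "cplx ` S - {cplx p} = cplx ` (S - {p})"
      using image_set_diff[OF inj_cplx, of S "{p}"] by simp
    then show ?thesis
      by (simp add: span_cplx_image cplx_in_complexification fun_vs.subspace_span)
  qed
  then show ?thesis
    by (auto simp: fun_vs.dependent_def)
qed

lemma basis_family_cplx:
  assumes "fun_vs.subspace V"
  shows "basis_family n (\<lambda>k. cplx (P k)) (complexification V) \<longleftrightarrow> basis_family n P V"
proof -
  have "(\<lambda>k. cplx (P k)) ` {..n} = cplx ` P ` {..n}"
    by (simp add: image_image)
  moreover have "inj_on (\<lambda>k. cplx (P k)) {..n} \<longleftrightarrow> inj_on P {..n}"
    using inj_cplx by (auto simp: inj_on_def)
  ultimately show ?thesis
    by (simp add: basis_family_def span_cplx_image independent_cplx_image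
        complexification_eq_iff assms fun_vs.subspace_span)
qed


section \<open>Bases\<close>

lemma basis_family_cong:
  assumes "\<And>k. k \<le> n \<Longrightarrow> F k = G k"
  shows "basis_family n F V \<longleftrightarrow> basis_family n G V"
proof -
  have "F ` {..n} = G ` {..n}" using assms by auto
  moreover have "inj_on F {..n} \<longleftrightarrow> inj_on G {..n}" using assms by (intro inj_on_cong) auto
  ultimately show ?thesis by (simp add: basis_family_def)
qed

lemma complex_ONB_cong:
  assumes "\<And>k. k \<le> n \<Longrightarrow> F k = G k"
  shows "complex_ONB \<Omega> W n F \<longleftrightarrow> complex_ONB \<Omega> W n G"
  using assms basis_family_cong[of n F G] by (simp add: complex_ONB_def)

lemma basis_family_mem: "basis_family n F V \<Longrightarrow> k \<le> n \<Longrightarrow> F k \<in> V"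
  using fun_vs.span_base[of "F k" "F ` {..n}"] by (auto simp: basis_family_def)

text \<open>A spanning family indexed by \<open>n + 1\<close> numbers is a basis as soon as the dimension is \<open>n + 1\<close>: it
  contains an independent spanning subset, whose cardinality forces it to be everything and the
  indexing to be injective. In this form the property depends on the family through its span alone.\<close>

lemma basis_family_iff_dim:
  "basis_family n F V \<longleftrightarrow> fun_vs.span (F ` {..n}) = V \<and> fun_vs.dim V = n + 1"
proof
  assume F: "basis_family n F V"
  then have "fun_vs.dim V = card (F ` {..n})"
    unfolding basis_family_def
    by (metis fun_vs.dim_span_eq_card_independent)
  with F show "fun_vs.span (F ` {..n}) = V \<and> fun_vs.dim V = n + 1"
    by (simp add: basis_family_def card_image)
next
  assume F: "fun_vs.span (F ` {..n}) = V \<and> fun_vs.dim V = n + 1"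
  have le: "card (F ` {..n}) \<le> n + 1"
    using card_image_le[of "{..n}" F] by simp
  have "n + 1 \<le> card (F ` {..n})"
    using F fun_vs.dim_le_card[of V "F ` {..n}"] by simp
  with le have card: "card (F ` {..n}) = n + 1" by simp
  then have "inj_on F {..n}"
    by (intro eq_card_imp_inj_on) auto
  moreover have "fun_vs.independent (F ` {..n})"
  proof -
    obtain B where B: "B \<subseteq> F ` {..n}" "fun_vs.independent B" "F ` {..n} \<subseteq> fun_vs.span B"
      using fun_vs.maximal_independent_subset[of "F ` {..n}"] by blast
    have "fun_vs.span B = V"
      using B F fun_vs.span_eq[of B "F ` {..n}"] fun_vs.span_superset[of "F ` {..n}"] by auto
    then have "card B = card (F ` {..n})"
      using B(2) F card fun_vs.dim_span_eq_card_independent[of B] by simp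
    then have "B = F ` {..n}"
      using B(1) by (intro card_subset_eq) auto
    with B(2) show ?thesis by simp
  qed
  ultimately show "basis_family n F V"
    using F by (simp add: basis_family_def)
qed

lemma basis_family_exchange:
  assumes "\<And>k. k \<le> n \<Longrightarrow> F k \<in> fun_vs.span (G ` {..n})"
    and "\<And>k. k \<le> n \<Longrightarrow> G k \<in> fun_vs.span (F ` {..n})"
  shows "basis_family n F V \<longleftrightarrow> basis_family n G V"
proof -
  have "fun_vs.span (F ` {..n}) = fun_vs.span (G ` {..n})"
    using assms by (auto simp: fun_vs.span_eq)
  then show ?thesis by (simp add: basis_family_iff_dim)
qed

text \<open>The families of monomials are given by indices, so coefficients are attached to the indices rather than to
  the functions, even if different indices give the same function.\<close>

lemma span_finite_image:
  assumes "finite A"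
  shows "fun_vs.span (g ` A) = {f. \<exists>c. f = (\<lambda>x. \<Sum>a\<in>A. c a * g a x)}"
  using assms
proof (induction A rule: finite_induct)
  case empty
  then show ?case by (auto simp: func_zero)
next
  case (insert b A)
  have "f \<in> fun_vs.span (g ` insert b A) \<longleftrightarrow>
      (\<exists>c. f = (\<lambda>x. \<Sum>a\<in>insert b A. c a * g a x))" for f
  proof
    assume "f \<in> fun_vs.span (g ` insert b A)"
    then obtain k where "f - fun_scale k (g b) \<in> fun_vs.span (g ` A)"
      by (auto simp: fun_vs.span_insert)
    then obtain c where "f - fun_scale k (g b) = (\<lambda>x. \<Sum>a\<in>A. c a * g a x)"
      by (auto simp: insert.IH)
    then have "f = (\<lambda>x. k * g b x + (\<Sum>a\<in>A. c a * g a x))"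
      by (auto simp: fun_scale_apply fun_eq_iff algebra_simps)
    also have "\<dots> = (\<lambda>x. \<Sum>a\<in>insert b A. (c(b := k)) a * g a x)"
      using insert.hyps by (auto simp: fun_scale_apply fun_eq_iff intro!: sum.cong)
    finally show "\<exists>c. f = (\<lambda>x. \<Sum>a\<in>insert b A. c a * g a x)" by blast
  next
    assume "\<exists>c. f = (\<lambda>x. \<Sum>a\<in>insert b A. c a * g a x)"
    then obtain c where c: "f = (\<lambda>x. \<Sum>a\<in>insert b A. c a * g a x)" ..
    have "f - fun_scale (c b) (g b) = (\<lambda>x. \<Sum>a\<in>A. c a * g a x)"
      using insert.hyps by (auto simp: c fun_scale_apply fun_eq_iff)
    then show "f \<in> fun_vs.span (g ` insert b A)"
      using insert.IH by (auto simp: fun_vs.span_insert)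
  qed
  then show ?case by blast
qed


section \<open>Polynomials generated by two functions\<close>

text \<open>The polynomials in \<open>x, y\<close> and those in \<open>z\<close> and its conjugate are both of this form. Treating the
  pair of generators as a parameter reduces the comparison of the two to a linear change of
  generators.\<close>

definition poly_span :: "('b \<Rightarrow> 'a::field) \<Rightarrow> ('b \<Rightarrow> 'a) \<Rightarrow> int \<Rightarrow> ('b \<Rightarrow> 'a) set" where
  "poly_span u v d = fun_vs.span ((\<lambda>(i, j) x. u x ^ i * v x ^ j) ` {(i, j). int (i + j) \<le> d})"

lemma monomial_in_poly_span:
  "int (i + j) \<le> d \<Longrightarrow> (\<lambda>x. u x ^ i * v x ^ j) \<in> poly_span u v d"
  unfolding poly_span_def by (rule fun_vs.span_base) force

lemma subspace_poly_span: "fun_vs.subspace (poly_span u v d)"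
  by (simp add: poly_span_def fun_vs.subspace_span)

lemma poly_span_mono: "d \<le> e \<Longrightarrow> poly_span u v d \<subseteq> poly_span u v e"
  unfolding poly_span_def by (intro fun_vs.span_mono image_mono) auto

text \<open>Products of monomials are monomials, and the product is linear in each factor; hence an
  induction over the span for each of the two factors.\<close>

lemma poly_span_mult:
  assumes "f \<in> poly_span u v d" "g \<in> poly_span u v e"
  shows "f * g \<in> poly_span u v (d + e)"
proof -
  note sub = subspace_poly_span[of u v "d + e"]
  have mono: "f * g \<in> poly_span u v (d + e)"
    if f: "f = (\<lambda>x. u x ^ i * v x ^ j)" and ij: "int (i + j) \<le> d" for f i j
    using assms(2) unfolding poly_span_def[of u v e]
  proof (induction rule: fun_vs.span_induct_alt)
    case base
    then show ?case unfolding mult_zero_right by (rule fun_vs.subspace_0[OF sub])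
  next
    case (step c h g)
    then obtain k l where h: "h = (\<lambda>x. u x ^ k * v x ^ l)" and kl: "int (k + l) \<le> e" by auto
    have "f * h = (\<lambda>x. u x ^ (i + k) * v x ^ (j + l))"
      by (auto simp: f h power_add fun_eq_iff)
    moreover have "int ((i + k) + (j + l)) \<le> d + e" using ij kl by simp
    ultimately have "f * h \<in> poly_span u v (d + e)"
      using monomial_in_poly_span by metis
    then have "fun_scale c (f * h) + f * g \<in> poly_span u v (d + e)"
      using step.IH by (intro fun_vs.subspace_add[OF sub] fun_vs.subspace_scale[OF sub])
    moreover have "f * (fun_scale c h + g) = fun_scale c (f * h) + f * g"
      by (auto simp: fun_scale_apply fun_eq_iff algebra_simps)
    ultimately show ?case by (simp only:)
  qed
  show ?thesis
    using assms(1) unfolding poly_span_def[of u v d]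
  proof (induction rule: fun_vs.span_induct_alt)
    case base
    then show ?case unfolding mult_zero_left by (rule fun_vs.subspace_0[OF sub])
  next
    case (step c h f)
    then obtain k l where "h = (\<lambda>x. u x ^ k * v x ^ l)" "int (k + l) \<le> d" by auto
    then have "fun_scale c (h * g) + f * g \<in> poly_span u v (d + e)"
      using step.IH mono by (intro fun_vs.subspace_add[OF sub] fun_vs.subspace_scale[OF sub])
    moreover have "(fun_scale c h + f) * g = fun_scale c (h * g) + f * g"
      by (auto simp: fun_scale_apply fun_eq_iff algebra_simps)
    ultimately show ?case by (simp only:)
  qed
qed

lemma power_in_poly_span:
  assumes "f \<in> poly_span u v 1"
  shows "(\<lambda>x. f x ^ i) \<in> poly_span u v (int i)"
proof (induction i)
  case 0
  show ?case using monomial_in_poly_span[of 0 0 0 u v] by simp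
next
  case (Suc i)
  have "(\<lambda>x. f x ^ Suc i) = f * (\<lambda>x. f x ^ i)" by (simp add: fun_scale_apply fun_eq_iff)
  then show ?case using poly_span_mult[OF assms Suc.IH] by simp
qed

text \<open>A linear change of generators does not raise the degree.\<close>

lemma poly_span_subset:
  assumes "u' \<in> poly_span u v 1" "v' \<in> poly_span u v 1"
  shows "poly_span u' v' d \<subseteq> poly_span u v d"
proof -
  have "(\<lambda>x. u' x ^ i * v' x ^ j) \<in> poly_span u v d" if "int (i + j) \<le> d" for i j
  proof -
    have "(\<lambda>x. u' x ^ i) * (\<lambda>x. v' x ^ j) \<in> poly_span u v (int i + int j)"
      by (intro poly_span_mult power_in_poly_span assms)
    moreover have "(\<lambda>x. u' x ^ i) * (\<lambda>x. v' x ^ j) = (\<lambda>x. u' x ^ i * v' x ^ j)"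
      by (simp add: fun_scale_apply fun_eq_iff)
    ultimately show ?thesis
      using poly_span_mono[of "int i + int j" d u v] that by auto
  qed
  then show ?thesis
    unfolding poly_span_def[of u' v']
    by (intro fun_vs.span_minimal subspace_poly_span) auto
qed

lemma poly_span_linear:
  assumes "f = fun_scale a u + fun_scale b v"
  shows "f \<in> poly_span u v 1"
  unfolding assms
  using monomial_in_poly_span[of 1 0 1 u v] monomial_in_poly_span[of 0 1 1 u v]
  by (intro fun_vs.subspace_add[OF subspace_poly_span] fun_vs.subspace_scale[OF subspace_poly_span])
     auto

lemma poly_span_eq_sums:
  "poly_span u v d =
     {f. \<exists>c. f = (\<lambda>x. \<Sum>(i, j)\<in>{(i, j). int (i + j) \<le> d}. c i j * u x ^ i * v x ^ j)}"
  (is "_ = {f. \<exists>c. f = ?S c}")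
proof -
  have "(\<exists>c. f = (\<lambda>x. \<Sum>a\<in>{(i, j). int (i + j) \<le> d}. c a * (case a of (i, j) \<Rightarrow> \<lambda>x. u x ^ i * v x ^ j) x))
      \<longleftrightarrow> (\<exists>c. f = ?S c)" (is "(\<exists>c. f = ?T c) \<longleftrightarrow> _") for f
  proof
    assume "\<exists>c. f = ?T c"
    then obtain c where "f = ?T c" ..
    then have "f = ?S (\<lambda>i j. c (i, j))" by (simp add: case_prod_unfold mult.assoc)
    then show "\<exists>c. f = ?S c" by (rule exI[where P = "\<lambda>c. f = ?S c"])
  next
    assume "\<exists>c. f = ?S c"
    then obtain c where "f = ?S c" ..
    then have "f = ?T (\<lambda>(i, j). c i j)" by (simp add: case_prod_unfold mult.assoc)
    then show "\<exists>c. f = ?T c" by (rule exI[where P = "\<lambda>c. f = ?T c"])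
  qed
  then show ?thesis
    unfolding poly_span_def span_finite_image[OF finite_exponents]
    by (auto simp: case_prod_unfold)
qed

lemma real_polys_eq_poly_span: "real_polys d = poly_span fst snd d"
  by (simp add: real_polys_def poly_span_eq_sums case_prod_unfold)

text \<open>The functions \<open>z\<close>, \<open>cnj z\<close> and the coordinates \<open>x\<close>, \<open>y\<close> are linear combinations of each other, so
  they generate the same complex polynomials of each degree. Written in \<open>x\<close> and \<open>y\<close>, the generating
  monomials are real valued, and \<open>span_cplx_image\<close> applies.\<close>

lemma complex_polys_eq_complexification: "complex_polys d = complexification (real_polys d)"
proof -
  have "complex_polys d = poly_span (\<lambda>z. z) cnj d"
    by (simp add: complex_polys_def poly_span_eq_sums)
  also have "\<dots> = poly_span (cplx fst) (cplx snd) d"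
  proof (intro equalityI poly_span_subset)
    show "(\<lambda>z. z) \<in> poly_span (cplx fst) (cplx snd) 1"
      by (rule poly_span_linear[where a = 1 and b = \<i>])
         (simp add: fun_scale_apply fun_eq_iff cplx_def complex_eq_iff)
    show "cnj \<in> poly_span (cplx fst) (cplx snd) 1"
      by (rule poly_span_linear[where a = 1 and b = "- \<i>"])
         (simp add: fun_scale_apply fun_eq_iff cplx_def complex_eq_iff)
    show "cplx fst \<in> poly_span (\<lambda>z. z) cnj 1"
      by (rule poly_span_linear[where a = "1 / 2" and b = "1 / 2"])
         (simp add: fun_scale_apply fun_eq_iff cplx_def complex_eq_iff)
    show "cplx snd \<in> poly_span (\<lambda>z. z) cnj 1"
      by (rule poly_span_linear[where a = "- \<i> / 2" and b = "\<i> / 2"])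
         (simp add: fun_scale_apply fun_eq_iff cplx_def complex_eq_iff)
  qed
  also have "\<dots> = complexification (real_polys d)"
  proof -
    have "(\<lambda>(i, j) x. cplx fst x ^ i * cplx snd x ^ j) =
        (\<lambda>a. cplx (case a of (i, j) \<Rightarrow> \<lambda>x. fst x ^ i * snd x ^ j))"
      by (auto simp: fun_scale_apply fun_eq_iff cplx_def)
    then show ?thesis
      by (simp add: poly_span_def real_polys_eq_poly_span image_image flip: span_cplx_image)
  qed
  finally show ?thesis .
qed

lemma subspace_real_polys: "fun_vs.subspace (real_polys d)"
  by (simp add: real_polys_eq_poly_span subspace_poly_span)

lemma real_polys_mult: "f \<in> real_polys d \<Longrightarrow> g \<in> real_polys e \<Longrightarrow> f * g \<in> real_polys (d + e)"
  by (simp add: real_polys_eq_poly_span poly_span_mult)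

lemma subspace_complex_polys: "fun_vs.subspace (complex_polys d)"
  by (simp add: complex_polys_eq_complexification subspace_complexification subspace_real_polys)


section \<open>The two inner products\<close>

text \<open>The integral is additive only on integrable functions, so additivity of the inner products is
  confined to polynomials.\<close>

lemma real_inner_integrable:
  assumes "admissible_weight \<Omega> W" "f \<in> real_polys d" "g \<in> real_polys e"
  shows "set_integrable lebesgue \<Omega> (\<lambda>a. f a * g a * W a)"
  using assms(1) real_polys_mult[OF assms(2,3)]
  unfolding admissible_weight_def by (force simp: times_fun_def)

lemma real_inner_add_left:
  assumes "admissible_weight \<Omega> W" "f \<in> real_polys d" "g \<in> real_polys d" "h \<in> real_polys e"
  shows "real_inner_W \<Omega> W (f + g) h = real_inner_W \<Omega> W f h + real_inner_W \<Omega> W g h"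
  using real_inner_integrable[OF assms(1,2,4)] real_inner_integrable[OF assms(1,3,4)]
  unfolding real_inner_W_def
  by (subst set_integral_add(2)[symmetric]) (auto simp: algebra_simps)

lemma real_inner_scale_left:
  "real_inner_W \<Omega> W (fun_scale c f) h = c * real_inner_W \<Omega> W f h"
  unfolding real_inner_W_def set_integral_mult_right[symmetric] by (simp add: fun_scale_apply mult.assoc)

lemma subspace_real_OP:
  assumes "admissible_weight \<Omega> W"
  shows "fun_vs.subspace (real_OP \<Omega> W n)"
  unfolding fun_vs.subspace_def real_OP_def
  using subspace_real_polys[of "int n"] real_inner_add_left[OF assms]
  by (auto simp: fun_vs.subspace_def real_inner_scale_left real_inner_W_def[of \<Omega> W 0])

text \<open>The product of \<open>f\<close> and the conjugate of \<open>g\<close> splits into four products of real polynomials.\<close>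

lemma complex_inner_integrable:
  assumes "admissible_weight \<Omega> W" "f \<in> complex_polys d" "g \<in> complex_polys e"
  shows "set_integrable lebesgue \<Omega>
    (\<lambda>a. f (to_complex a) * cnj (g (to_complex a)) * complex_of_real (W a))"
proof -
  have f: "re_part f \<in> real_polys d" "im_part f \<in> real_polys d"
    and g: "re_part g \<in> real_polys e" "im_part g \<in> real_polys e"
    using assms by (auto simp: complex_polys_eq_complexification complexification_def)
  have int: "set_integrable lebesgue \<Omega> (\<lambda>a. complex_of_real (p a * q a * W a))"
    if "p \<in> real_polys d" "q \<in> real_polys e" for p q
    using real_inner_integrable[OF assms(1) that] unfolding set_integrable_def
    by (auto simp: scaleR_conv_of_real simp flip: of_real_mult intro: integrable_of_real)
  have "set_integrable lebesgue \<Omega> (\<lambda>a.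
      (complex_of_real (re_part f a * re_part g a * W a) +
       complex_of_real (im_part f a * im_part g a * W a)) +
      \<i> * (complex_of_real (im_part f a * re_part g a * W a) -
          complex_of_real (re_part f a * im_part g a * W a)))"
    using f g by (intro set_integral_add set_integral_diff set_integrable_mult_right int)
  moreover have "f (to_complex a) * cnj (g (to_complex a)) * complex_of_real (W a) =
      (complex_of_real (re_part f a * re_part g a * W a) +
       complex_of_real (im_part f a * im_part g a * W a)) +
      \<i> * (complex_of_real (im_part f a * re_part g a * W a) -
          complex_of_real (re_part f a * im_part g a * W a))" for a
    by (simp add: re_part_def im_part_def complex_eq_iff algebra_simps)
  ultimately show ?thesis by simp
qed

lemma complex_inner_add_left:
  assumes "admissible_weight \<Omega> W" "f \<in> complex_polys d" "g \<in> complex_polys d"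
    "h \<in> complex_polys e"
  shows "complex_inner_W \<Omega> W (f + g) h = complex_inner_W \<Omega> W f h + complex_inner_W \<Omega> W g h"
  using complex_inner_integrable[OF assms(1,2,4)] complex_inner_integrable[OF assms(1,3,4)]
  unfolding complex_inner_W_def
  by (subst set_integral_add(2)[symmetric]) (auto simp: algebra_simps)

lemma complex_inner_scale_left:
  "complex_inner_W \<Omega> W (fun_scale c f) h = c * complex_inner_W \<Omega> W f h"
  unfolding complex_inner_W_def set_integral_mult_right[symmetric] by (simp add: fun_scale_apply mult.assoc)

lemma complex_inner_cnj: "cnj (complex_inner_W \<Omega> W f g) = complex_inner_W \<Omega> W g f"
  unfolding complex_inner_W_def set_lebesgue_integral_def
  by (subst Bochner_Integration.integral_cnj[symmetric], rule Bochner_Integration.integral_cong) (simp_all add: mult.commute mult.left_commute)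

lemma complex_inner_add_right:
  assumes "admissible_weight \<Omega> W" "f \<in> complex_polys d" "g \<in> complex_polys d"
    "h \<in> complex_polys e"
  shows "complex_inner_W \<Omega> W h (f + g) = complex_inner_W \<Omega> W h f + complex_inner_W \<Omega> W h g"
  using complex_inner_add_left[OF assms] complex_inner_cnj[of \<Omega> W _ h]
  by (metis complex_cnj_add)

lemma complex_inner_scale_right:
  "complex_inner_W \<Omega> W h (fun_scale c f) = cnj c * complex_inner_W \<Omega> W h f"
  by (metis complex_inner_cnj complex_inner_scale_left complex_cnj_mult)

lemma complex_inner_cplx:
  "complex_inner_W \<Omega> W (cplx f) (cplx g) = complex_of_real (real_inner_W \<Omega> W f g)"
  unfolding complex_inner_W_def real_inner_W_def set_integral_complex_of_real[symmetric]
  by simp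

text \<open>Against a real \<open>q\<close>, the inner product of \<open>u + i v\<close> has real part \<open>\<langle>u, q\<rangle>\<close> and imaginary part \<open>\<langle>v, q\<rangle>\<close>, so
  orthogonality to all real \<open>q\<close> of lower degree means orthogonality of both \<open>u\<close> and \<open>v\<close>. By sesquilinearity it
  makes no difference whether one tests with real or with complex polynomials.\<close>

lemma complex_OP_eq_complexification:
  assumes "admissible_weight \<Omega> W"
  shows "complex_OP \<Omega> W n = complexification (real_OP \<Omega> W n)"
proof -
  have cplx_poly: "cplx p \<in> complex_polys d \<longleftrightarrow> p \<in> real_polys d" for p d
    by (simp add: complex_polys_eq_complexification cplx_in_complexification subspace_real_polys)
  have split: "complex_inner_W \<Omega> W f (cplx q) =
      complex_of_real (real_inner_W \<Omega> W (re_part f) q) +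
      \<i> * complex_of_real (real_inner_W \<Omega> W (im_part f) q)"
    if "f \<in> complex_polys d" "q \<in> real_polys e" for f q d e
  proof -
    have *: "cplx (re_part f) \<in> complex_polys d" "cplx (im_part f) \<in> complex_polys d"
      using that(1) unfolding cplx_poly
      by (simp_all add: complex_polys_eq_complexification complexification_def)
    have "complex_inner_W \<Omega> W f (cplx q) =
        complex_inner_W \<Omega> W (cplx (re_part f) + fun_scale \<i> (cplx (im_part f))) (cplx q)"
      using cplx_re_im[of f] by simp
    also have "\<dots> = complex_inner_W \<Omega> W (cplx (re_part f)) (cplx q) +
        \<i> * complex_inner_W \<Omega> W (cplx (im_part f)) (cplx q)"
      using * that(2)
      by (subst complex_inner_add_left[OF assms, where d = d and e = e])
         (auto simp: cplx_poly complex_inner_scale_left fun_vs.subspace_scale[OF subspace_complex_polys])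
    finally show ?thesis by (simp add: complex_inner_cplx)
  qed
  have "f \<in> complex_OP \<Omega> W n \<longleftrightarrow> re_part f \<in> real_OP \<Omega> W n \<and> im_part f \<in> real_OP \<Omega> W n" for f
  proof (cases "f \<in> complex_polys (int n)")
    case True
    have "(\<forall>Q\<in>complex_polys (int n - 1). complex_inner_W \<Omega> W f Q = 0) \<longleftrightarrow>
        (\<forall>q\<in>real_polys (int n - 1). complex_inner_W \<Omega> W f (cplx q) = 0)" (is "?L \<longleftrightarrow> ?R")
    proof
      assume ?L then show ?R by (simp add: cplx_poly)
    next
      assume R: ?R
      show ?L
      proof
        fix Q assume Q: "Q \<in> complex_polys (int n - 1)"
        then have *: "re_part Q \<in> real_polys (int n - 1)" "im_part Q \<in> real_polys (int n - 1)"
          by (auto simp: complex_polys_eq_complexification complexification_def)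
        have "complex_inner_W \<Omega> W f Q =
            complex_inner_W \<Omega> W f (cplx (re_part Q) + fun_scale \<i> (cplx (im_part Q)))"
          using cplx_re_im[of Q] by simp
        also have "\<dots> = complex_inner_W \<Omega> W f (cplx (re_part Q)) +
            cnj \<i> * complex_inner_W \<Omega> W f (cplx (im_part Q))"
          using *
          by (subst complex_inner_add_right[OF assms, where d = "int n - 1" and e = "int n"])
             (auto simp: cplx_poly complex_inner_scale_right True
               intro!: fun_vs.subspace_scale[OF subspace_complex_polys])
        finally show "complex_inner_W \<Omega> W f Q = 0" using R * by simp
      qed
    qed
    also have "\<dots> \<longleftrightarrow> (\<forall>q\<in>real_polys (int n - 1).
        real_inner_W \<Omega> W (re_part f) q = 0 \<and> real_inner_W \<Omega> W (im_part f) q = 0)"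
      by (intro ball_cong refl) (simp add: split[OF True] complex_eq_iff)
    finally show ?thesis
      using True
      by (auto simp: complex_OP_def real_OP_def complex_polys_eq_complexification complexification_def)
  next
    case False
    then show ?thesis
      by (auto simp: complex_OP_def real_OP_def complex_polys_eq_complexification complexification_def)
  qed
  then show ?thesis by (auto simp: complexification_def)
qed

lemma complex_OP_polys: "f \<in> complex_OP \<Omega> W n \<Longrightarrow> f \<in> complex_polys (int n)"
  by (simp add: complex_OP_def)

lemma basis_family_cplx_OP:
  "admissible_weight \<Omega> W \<Longrightarrow>
     basis_family n (\<lambda>k. cplx (P k)) (complex_OP \<Omega> W n) \<longleftrightarrow> basis_family n P (real_OP \<Omega> W n)"
  by (simp add: complex_OP_eq_complexification basis_family_cplx subspace_real_OP)

lemma complex_ONB_cplx: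
  "admissible_weight \<Omega> W \<Longrightarrow> complex_ONB \<Omega> W n (\<lambda>k. cplx (P k)) \<longleftrightarrow> real_ONB \<Omega> W n P"
  by (simp add: complex_ONB_def real_ONB_def basis_family_cplx_OP complex_inner_cplx if_distrib)


section \<open>Unitary mixing of the members with indices k and n - k\<close>

definition mix :: "nat \<Rightarrow> (nat \<Rightarrow> 'a) \<Rightarrow> (nat \<Rightarrow> 'a) \<Rightarrow> (nat \<Rightarrow> 'b \<Rightarrow> 'a::field) \<Rightarrow> nat \<Rightarrow> 'b \<Rightarrow> 'a" where
  "mix n \<alpha> \<beta> E k = fun_scale (\<alpha> k) (E k) + fun_scale (\<beta> k) (E (n - k))"

lemma mix_in_span: "k \<le> n \<Longrightarrow> mix n \<alpha> \<beta> E k \<in> fun_vs.span (E ` {..n})"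
  unfolding mix_def
  by (intro fun_vs.span_add fun_vs.span_scale fun_vs.span_base) auto

text \<open>For \<open>2 k \<noteq> n\<close> these are the row conditions for the matrix of the mixing, which acts on the pair of
  indices \<open>k\<close> and \<open>n - k\<close>, to be unitary. For \<open>2 k = n\<close> the two indices coincide; the single member is
  then only multiplied by a number of modulus one.\<close>

definition unitary_mix :: "nat \<Rightarrow> (nat \<Rightarrow> complex) \<Rightarrow> (nat \<Rightarrow> complex) \<Rightarrow> bool" where
  "unitary_mix n \<alpha> \<beta> \<longleftrightarrow>
     (\<forall>k\<le>n. \<alpha> k * cnj (\<alpha> k) + \<beta> k * cnj (\<beta> k) = 1 \<and>
        (if 2 * k = n then \<beta> k = 0
         else \<alpha> k * cnj (\<beta> (n - k)) + \<beta> k * cnj (\<alpha> (n - k)) = 0))"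

lemma complex_inner_mix:
  assumes "admissible_weight \<Omega> W"
    and E: "\<And>k. k \<le> n \<Longrightarrow> E k \<in> complex_polys d" and "j \<le> n" "k \<le> n"
  shows "complex_inner_W \<Omega> W (mix n \<alpha> \<beta> E j) (mix n \<alpha> \<beta> E k) =
      \<alpha> j * cnj (\<alpha> k) * complex_inner_W \<Omega> W (E j) (E k) +
      \<alpha> j * cnj (\<beta> k) * complex_inner_W \<Omega> W (E j) (E (n - k)) +
      \<beta> j * cnj (\<alpha> k) * complex_inner_W \<Omega> W (E (n - j)) (E k) +
      \<beta> j * cnj (\<beta> k) * complex_inner_W \<Omega> W (E (n - j)) (E (n - k))"
proof -
  have mem: "fun_scale c (E i) \<in> complex_polys d" if "i \<le> n" for c i
    using E[OF that] by (rule fun_vs.subspace_scale[OF subspace_complex_polys])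
  have right: "complex_inner_W \<Omega> W (fun_scale c (E i)) (mix n \<alpha> \<beta> E k) =
      c * (cnj (\<alpha> k) * complex_inner_W \<Omega> W (E i) (E k) +
           cnj (\<beta> k) * complex_inner_W \<Omega> W (E i) (E (n - k)))" if "i \<le> n" for c i
    unfolding mix_def
    by (subst complex_inner_add_right[OF assms(1), where d = d and e = d])
       (auto simp: mem that assms(4) complex_inner_scale_left complex_inner_scale_right algebra_simps)
  have "complex_inner_W \<Omega> W (mix n \<alpha> \<beta> E j) (mix n \<alpha> \<beta> E k) =
      complex_inner_W \<Omega> W (fun_scale (\<alpha> j) (E j)) (mix n \<alpha> \<beta> E k) +
      complex_inner_W \<Omega> W (fun_scale (\<beta> j) (E (n - j))) (mix n \<alpha> \<beta> E k)"
    unfolding mix_def[of n \<alpha> \<beta> E j]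
    by (rule complex_inner_add_left[OF assms(1), where d = d and e = d])
       (auto simp: mem assms(3,4) mix_def intro!: fun_vs.subspace_add[OF subspace_complex_polys])
  then show ?thesis
    by (simp add: right assms(3) algebra_simps)
qed

text \<open>Members whose indices are neither equal nor complementary involve disjoint sets of orthonormal
  vectors; for the remaining pairs the Gram matrix is given by the row conditions.\<close>

lemma orthonormal_mix:
  assumes "admissible_weight \<Omega> W" "unitary_mix n \<alpha> \<beta>"
    and E: "\<And>k. k \<le> n \<Longrightarrow> E k \<in> complex_polys d"
    and ON: "\<And>j k. j \<le> n \<Longrightarrow> k \<le> n \<Longrightarrow>
      complex_inner_W \<Omega> W (E j) (E k) = (if j = k then 1 else 0)"
    and "j \<le> n" "k \<le> n"
  shows "complex_inner_W \<Omega> W (mix n \<alpha> \<beta> E j) (mix n \<alpha> \<beta> E k) = (if j = k then 1 else 0)"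
proof -
  have "complex_inner_W \<Omega> W (mix n \<alpha> \<beta> E j) (mix n \<alpha> \<beta> E k) =
      (if j = k then \<alpha> j * cnj (\<alpha> j) + \<beta> j * cnj (\<beta> j) else 0) +
      (if j = n - k then \<alpha> j * cnj (\<beta> k) + \<beta> j * cnj (\<alpha> k) else 0)"
    using assms(5,6)
    by (subst complex_inner_mix[OF assms(1) E]) (auto simp: ON)
  moreover have "2 * j = n" if "j = k" "j = n - k"
    using that assms(5) by arith
  moreover have "k = n - j" if "j = n - k"
    using that assms(6) by simp
  moreover have "2 * j \<noteq> n" if "j \<noteq> k" "j = n - k"
    using that assms(6) by arith
  moreover have "n - j = j" if "2 * j = n" using that by simp
  moreover have "\<alpha> j * cnj (\<alpha> j) + \<beta> j * cnj (\<beta> j) = 1"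
    "2 * j = n \<Longrightarrow> \<beta> j = 0"
    "2 * j \<noteq> n \<Longrightarrow> \<alpha> j * cnj (\<beta> (n - j)) + \<beta> j * cnj (\<alpha> (n - j)) = 0"
    using assms(2,5) by (auto simp: unitary_mix_def)
  ultimately show ?thesis by (cases "j = k"; cases "j = n - k") auto
qed

text \<open>The spans agree because each family is a combination of the other. Orthonormality is carried over
  by one mixing in each direction.\<close>

lemma complex_ONB_mix:
  assumes "admissible_weight \<Omega> W"
    and "unitary_mix n \<alpha> \<beta>" "\<And>k. k \<le> n \<Longrightarrow> F k = mix n \<alpha> \<beta> E k"
    and "unitary_mix n \<gamma> \<delta>" "\<And>k. k \<le> n \<Longrightarrow> E k = mix n \<gamma> \<delta> F k"
  shows "basis_family n F (complex_OP \<Omega> W n) \<longleftrightarrow> basis_family n E (complex_OP \<Omega> W n)"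
    and "complex_ONB \<Omega> W n F \<longleftrightarrow> complex_ONB \<Omega> W n E"
proof -
  show basis: "basis_family n F (complex_OP \<Omega> W n) \<longleftrightarrow> basis_family n E (complex_OP \<Omega> W n)"
    by (rule basis_family_exchange) (simp add: assms(3) mix_in_span, subst assms(5), auto simp: mix_in_span)
  have ON: "complex_inner_W \<Omega> W (G' j) (G' k) = (if j = k then 1 else 0)"
    if "complex_ONB \<Omega> W n G" "unitary_mix n a b" "\<And>k. k \<le> n \<Longrightarrow> G' k = mix n a b G k"
      "j \<le> n" "k \<le> n" for G G' a b j k
  proof -
    have "G k \<in> complex_polys (int n)" if "k \<le> n" for k
      using \<open>complex_ONB \<Omega> W n G\<close> that basis_family_mem complex_OP_polys
      unfolding complex_ONB_def by blast
    then show ?thesis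
      using orthonormal_mix[OF assms(1) that(2), of G "int n" j k] that
      by (simp add: complex_ONB_def)
  qed
  show "complex_ONB \<Omega> W n F \<longleftrightarrow> complex_ONB \<Omega> W n E"
  proof
    assume F: "complex_ONB \<Omega> W n F"
    then show "complex_ONB \<Omega> W n E"
      using basis ON[OF F assms(4,5)] unfolding complex_ONB_def by blast
  next
    assume E: "complex_ONB \<Omega> W n E"
    then show "complex_ONB \<Omega> W n F"
      using basis ON[OF E assms(2,3)] unfolding complex_ONB_def by blast
  qed
qed


section \<open>The transformation between P and Q\<close>

lemma Q_of_P_cong:
  assumes "\<And>k. k \<le> n \<Longrightarrow> P k = P' k" "k \<le> n"
  shows "Q_of_P n P k = Q_of_P n P' k"
  using assms by (simp add: Q_of_P_def fun_eq_iff Let_def)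

lemma sqrt2_mult_self [simp]: "complex_of_real (sqrt 2) * complex_of_real (sqrt 2) = 2"
  by (simp flip: of_real_mult)

lemma sqrt2_mult_left [simp]: "complex_of_real (sqrt 2) * (complex_of_real (sqrt 2) * c) = 2 * c"
  by (simp flip: mult.assoc)

definition Q_coeff_same :: "nat \<Rightarrow> nat \<Rightarrow> complex" where
  "Q_coeff_same n k =
     (if 2 * k < n then 1 / complex_of_real (sqrt 2)
      else if n < 2 * k then \<i> / complex_of_real (sqrt 2) else 1)"

definition Q_coeff_opposite :: "nat \<Rightarrow> nat \<Rightarrow> complex" where
  "Q_coeff_opposite n k =
     (if 2 * k < n then - \<i> / complex_of_real (sqrt 2)
      else if n < 2 * k then 1 / complex_of_real (sqrt 2) else 0)"

text \<open>The inverse mixing; for \<open>2 k > n\<close> the coefficients are those of the difference of two members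
  divided by \<open>\<surd>2 i\<close>, written with \<open>1 / i = - i\<close>.\<close>

definition P_coeff_same :: "nat \<Rightarrow> nat \<Rightarrow> complex" where
  "P_coeff_same n k =
     (if 2 * k < n then 1 / complex_of_real (sqrt 2)
      else if n < 2 * k then - \<i> / complex_of_real (sqrt 2) else 1)"

definition P_coeff_opposite :: "nat \<Rightarrow> nat \<Rightarrow> complex" where
  "P_coeff_opposite n k =
     (if 2 * k < n then 1 / complex_of_real (sqrt 2)
      else if n < 2 * k then \<i> / complex_of_real (sqrt 2) else 0)"

text \<open>Since \<open>Q\<close> has the middle member \<open>P / \<surd>2\<close>, the rescaled family is the one that is mixed unitarily.\<close>

lemma Q_of_P_eq_mix:
  assumes "k \<le> n"
  shows "Q_of_P n (complexify P) k =
    mix n (Q_coeff_same n) (Q_coeff_opposite n) (\<lambda>k. cplx (rescale_middle n P k)) k"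
  using assms
  by (auto simp: Q_of_P_def mix_def fun_scale_apply fun_eq_iff Let_def complexify_def cplx_def
      rescale_middle_def Q_coeff_same_def Q_coeff_opposite_def field_simps)

text \<open>These are the defining equations of \<open>P\<close> in terms of \<open>Q\<close>, except that the rescaled middle member
  is \<open>Q\<close> itself and not \<open>\<surd>2 Q\<close>.\<close>

lemma cplx_P_eq_mix:
  assumes "k \<le> n"
  shows "cplx (rescale_middle n P k) =
    mix n (P_coeff_same n) (P_coeff_opposite n) (Q_of_P n (complexify P)) k"
  using assms
  by (auto simp: Q_of_P_def mix_def fun_scale_apply fun_eq_iff Let_def complexify_def cplx_def
      rescale_middle_def P_coeff_same_def P_coeff_opposite_def field_simps)

lemma unitary_mix_Q: "unitary_mix n (Q_coeff_same n) (Q_coeff_opposite n)"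
  by (auto simp: unitary_mix_def Q_coeff_same_def Q_coeff_opposite_def)

lemma unitary_mix_P: "unitary_mix n (P_coeff_same n) (P_coeff_opposite n)"
  by (auto simp: unitary_mix_def P_coeff_same_def P_coeff_opposite_def)

lemma
  assumes "admissible_weight \<Omega> W"
  shows basis_family_Q_of_P_rescaled:
      "basis_family n (Q_of_P n (complexify P)) (complex_OP \<Omega> W n) \<longleftrightarrow>
       basis_family n (rescale_middle n P) (real_OP \<Omega> W n)"
    and complex_ONB_Q_of_P:
      "complex_ONB \<Omega> W n (Q_of_P n (complexify P)) \<longleftrightarrow> real_ONB \<Omega> W n (rescale_middle n P)"
  unfolding basis_family_cplx_OP[OF assms, symmetric] complex_ONB_cplx[OF assms, symmetric]
  by (rule complex_ONB_mix[OF assms unitary_mix_Q Q_of_P_eq_mix unitary_mix_P cplx_P_eq_mix];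
      assumption)+

lemma basis_family_rescale_middle:
  "basis_family n (rescale_middle n P) V \<longleftrightarrow> basis_family n (P :: nat \<Rightarrow> 'b \<Rightarrow> real) V"
proof (rule basis_family_exchange)
  fix k assume k: "k \<le> n"
  have "rescale_middle n P k = fun_scale (if 2 * k = n then 1 / sqrt 2 else 1) (P k)"
    by (auto simp: rescale_middle_def fun_scale_apply fun_eq_iff)
  then show "rescale_middle n P k \<in> fun_vs.span (P ` {..n})"
    using k by (auto intro!: fun_vs.span_scale intro: fun_vs.span_base)
  have "P k = fun_scale (if 2 * k = n then sqrt 2 else 1) (rescale_middle n P k)"
    by (auto simp: rescale_middle_def fun_scale_apply fun_eq_iff)
  moreover have "fun_scale (if 2 * k = n then sqrt 2 else 1) (rescale_middle n P k)
      \<in> fun_vs.span (rescale_middle n P ` {..n})"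
    using k by (intro fun_vs.span_scale fun_vs.span_base) auto
  ultimately show "P k \<in> fun_vs.span (rescale_middle n P ` {..n})" by simp
qed

lemma basis_family_Q_of_P:
  "admissible_weight \<Omega> W \<Longrightarrow>
   basis_family n (Q_of_P n (complexify P)) (complex_OP \<Omega> W n) \<longleftrightarrow> basis_family n P (real_OP \<Omega> W n)"
  by (simp add: basis_family_Q_of_P_rescaled basis_family_rescale_middle)

lemma conj_symmetric_Q_of_P: "conj_symmetric n (Q_of_P n (complexify P))"
  by (auto simp: conj_symmetric_def Q_of_P_def Let_def complexify_def)

lemma sqrt2_i_inverse:
  "1 / (complex_of_real (sqrt 2) * \<i>) = - \<i> / complex_of_real (sqrt 2)"
  by (simp add: divide_simps)

lemma Q_eq_Q_of_P:
  assumes "\<forall>k\<le>n. P_of_Q n Q k = complexify P k" "k \<le> n"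
  shows "Q k = Q_of_P n (complexify P) k"
  using assms Q_of_P_P_of_Q[OF assms(2), of Q] Q_of_P_cong[of n "P_of_Q n Q" "complexify P" k]
  by simp

text \<open>For a conjugate symmetric family, \<open>P\<close> consists of \<open>\<surd>2 Re Q\<close> and \<open>\<surd>2 Im Q\<close>. Conversely, every family
  that comes from a real \<open>P\<close> is visibly conjugate symmetric.\<close>

lemma conj_symmetric_iff_real_P:
  "conj_symmetric n Q \<longleftrightarrow> (\<exists>P. \<forall>k\<le>n. P_of_Q n Q k = complexify P k)"
proof
  assume Q: "conj_symmetric n Q"
  have "P_of_Q n Q k = complexify (\<lambda>k a. Re (P_of_Q n Q k a)) k" if "k \<le> n" for k
  proof (rule ext)
    fix a
    have "Q k (to_complex a) = cnj (Q (n - k) (to_complex a))"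
      using Q that unfolding conj_symmetric_def by blast
    then have "Im (P_of_Q n Q k a) = 0"
      unfolding P_of_Q_def Let_def sqrt2_i_inverse by simp
    then show "P_of_Q n Q k a = complexify (\<lambda>k a. Re (P_of_Q n Q k a)) k a"
      unfolding complexify_def by (simp add: complex_eq_iff)
  qed
  then show "\<exists>P. \<forall>k\<le>n. P_of_Q n Q k = complexify P k"
    by (intro exI[where x = "\<lambda>k a. Re (P_of_Q n Q k a)"]) (intro allI impI)
next
  assume "\<exists>P. \<forall>k\<le>n. P_of_Q n Q k = complexify P k"
  then obtain P where P: "\<forall>k\<le>n. P_of_Q n Q k = complexify P k" ..
  then have "Q k = Q_of_P n (complexify P) k" if "k \<le> n" for k
    using that by (rule Q_eq_Q_of_P)
  then show "conj_symmetric n Q"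
    using conj_symmetric_Q_of_P[of n P] unfolding conj_symmetric_def by (metis diff_le_self)
qed


section \<open>Reproducing kernels\<close>

text \<open>The induction over the span carries membership in the polynomials along, because the inner
  product is additive only there.\<close>

lemma ONB_expansion:
  assumes "admissible_weight \<Omega> W" "complex_ONB \<Omega> W n G" "f \<in> complex_OP \<Omega> W n"
  shows "f z = (\<Sum>k\<le>n. complex_inner_W \<Omega> W f (G k) * G k z)"
proof -
  have G: "G k \<in> complex_polys (int n)" if "k \<le> n" for k
    using assms(2) that basis_family_mem complex_OP_polys unfolding complex_ONB_def by blast
  have "f \<in> fun_vs.span (G ` {..n})"
    using assms(2,3) by (simp add: complex_ONB_def basis_family_def)
  then have "f \<in> complex_polys (int n) \<and>
      (\<forall>z. f z = (\<Sum>k\<le>n. complex_inner_W \<Omega> W f (G k) * G k z))"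
  proof (induction rule: fun_vs.span_induct_alt)
    case base
    show ?case
      using fun_vs.subspace_0[OF subspace_complex_polys[of "int n"]]
      by (simp add: func_zero complex_inner_W_def)
  next
    case (step c g h)
    then obtain j where j: "j \<le> n" "g = G j" by auto
    have cg: "fun_scale c g \<in> complex_polys (int n)"
      using j G by (auto intro: fun_vs.subspace_scale[OF subspace_complex_polys])
    have "complex_inner_W \<Omega> W (fun_scale c g + h) (G k) =
        c * (if j = k then 1 else 0) + complex_inner_W \<Omega> W h (G k)" if "k \<le> n" for k
      using complex_inner_add_left[OF assms(1) cg _ G[OF that], of h] step.IH j that assms(2)
      by (simp add: complex_inner_scale_left complex_ONB_def)
    then have "(\<Sum>k\<le>n. complex_inner_W \<Omega> W (fun_scale c g + h) (G k) * G k z) =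
        (\<Sum>k\<le>n. (if j = k then c * G k z else 0) + complex_inner_W \<Omega> W h (G k) * G k z)" for z
      by (intro sum.cong) (auto simp: algebra_simps)
    then have sum: "(\<Sum>k\<le>n. complex_inner_W \<Omega> W (fun_scale c g + h) (G k) * G k z) =
        c * G j z + (\<Sum>k\<le>n. complex_inner_W \<Omega> W h (G k) * G k z)" for z
      using j(1) by (simp add: sum.distrib)
    have h: "h z = (\<Sum>k\<le>n. complex_inner_W \<Omega> W h (G k) * G k z)" for z
      using step.IH by blast
    have "(fun_scale c g + h) z = c * G j z + h z" for z
      by (simp add: fun_scale_apply j(2))
    then have "(fun_scale c g + h) z =
        (\<Sum>k\<le>n. complex_inner_W \<Omega> W (fun_scale c g + h) (G k) * G k z)" for z
      unfolding sum h[of z, symmetric] .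
    moreover have "fun_scale c g + h \<in> complex_polys (int n)"
      using fun_vs.subspace_add[OF subspace_complex_polys cg] step.IH by blast
    ultimately show ?case by blast
  qed
  then show ?thesis by blast
qed

text \<open>Expanding \<open>F\<close> in terms of \<open>G\<close> and collecting the coefficients the other way round as an
  expansion of \<open>G\<close> in terms of \<open>F\<close> turns one kernel into the other.\<close>

lemma complex_kernel_unique:
  assumes "admissible_weight \<Omega> W" "complex_ONB \<Omega> W n F" "complex_ONB \<Omega> W n G"
  shows "(\<Sum>k\<le>n. F k z * cnj (F k w)) = (\<Sum>k\<le>n. G k z * cnj (G k w))"
proof -
  have mem: "F k \<in> complex_OP \<Omega> W n" "G k \<in> complex_OP \<Omega> W n" if "k \<le> n" for k
    using assms(2,3) that basis_family_mem unfolding complex_ONB_def by blast+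
  have "(\<Sum>k\<le>n. F k z * cnj (F k w)) =
      (\<Sum>k\<le>n. \<Sum>j\<le>n. complex_inner_W \<Omega> W (F k) (G j) * G j z * cnj (F k w))"
    by (intro sum.cong refl, subst ONB_expansion[OF assms(1,3) mem(1)])
       (auto simp: sum_distrib_right)
  also have "\<dots> = (\<Sum>j\<le>n. \<Sum>k\<le>n. complex_inner_W \<Omega> W (F k) (G j) * G j z * cnj (F k w))"
    by (rule sum.swap)
  also have "\<dots> = (\<Sum>j\<le>n. G j z * cnj (\<Sum>k\<le>n. complex_inner_W \<Omega> W (G j) (F k) * F k w))"
    by (auto simp: sum_distrib_left complex_inner_cnj algebra_simps intro!: sum.cong)
  also have "\<dots> = (\<Sum>j\<le>n. G j z * cnj (G j w))"
    by (intro sum.cong refl) (simp flip: ONB_expansion[OF assms(1,2) mem(2)])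
  finally show ?thesis .
qed

lemma P_kernels_agree:
  assumes "admissible_weight \<Omega> W" "real_ONB \<Omega> W m (p m)" "complex_ONB \<Omega> W m (q m)"
  shows "complex_P_kernel q m (Complex x y) (Complex u v) =
    complex_of_real (real_P_kernel p m (x, y) (u, v))"
proof -
  have "complex_ONB \<Omega> W m (\<lambda>k. cplx (p m k))"
    using assms(2) by (simp add: complex_ONB_cplx[OF assms(1)])
  from complex_kernel_unique[OF assms(1,3) this]
  show ?thesis
    by (simp add: complex_P_kernel_def real_P_kernel_def cplx_def)
qed


theorem theorem4p3:
  fixes \<Omega> :: "(real \<times> real) set" and W :: "real \<times> real \<Rightarrow> real" and n :: nat
  assumes "admissible_weight \<Omega> W"
  shows
    "(\<comment> \<open>(1), \<open>P\<close> defined from \<open>Q\<close>\<close>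
      \<forall>Q. (\<forall>k\<le>n. Q k \<in> complex_OP \<Omega> W n) \<longrightarrow>
        (basis_family n Q (complex_OP \<Omega> W n) \<and> conj_symmetric n Q \<longleftrightarrow>
         (\<exists>P. (\<forall>k\<le>n. P_of_Q n Q k = complexify P k) \<and> basis_family n P (real_OP \<Omega> W n)))) \<and>
     (\<comment> \<open>(1), \<open>Q\<close> defined from \<open>P\<close>\<close>
      \<forall>P. (\<forall>k\<le>n. P k \<in> real_OP \<Omega> W n) \<longrightarrow>
        (basis_family n (Q_of_P n (complexify P)) (complex_OP \<Omega> W n) \<and>
           conj_symmetric n (Q_of_P n (complexify P)) \<longleftrightarrow>
         basis_family n P (real_OP \<Omega> W n))) \<and>
     (\<comment> \<open>(2), \<open>P\<close> defined from \<open>Q\<close>\<close>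
      \<forall>Q. (\<forall>k\<le>n. Q k \<in> complex_OP \<Omega> W n) \<longrightarrow>
        (complex_ONB \<Omega> W n Q \<and> conj_symmetric n Q \<longleftrightarrow>
         (\<exists>P. (\<forall>k\<le>n. P_of_Q n Q k = complexify P k) \<and> real_ONB \<Omega> W n (rescale_middle n P)))) \<and>
     (\<comment> \<open>(2), \<open>Q\<close> defined from \<open>P\<close>\<close>
      \<forall>P. (\<forall>k\<le>n. P k \<in> real_OP \<Omega> W n) \<longrightarrow>
        (complex_ONB \<Omega> W n (Q_of_P n (complexify P)) \<longleftrightarrow>
         real_ONB \<Omega> W n (rescale_middle n P))) \<and>
     (\<comment> \<open>(3), kernels of degree \<open>n\<close>\<close>
      \<forall>p q. real_ONB \<Omega> W n (p n) \<longrightarrow> complex_ONB \<Omega> W n (q n) \<longrightarrow>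
        (\<forall>x y u v. complex_P_kernel q n (Complex x y) (Complex u v) =
                   complex_of_real (real_P_kernel p n (x, y) (u, v)))) \<and>
     (\<comment> \<open>(3), kernels up to degree \<open>n\<close>\<close>
      \<forall>p q. (\<forall>m\<le>n. real_ONB \<Omega> W m (p m)) \<longrightarrow> (\<forall>m\<le>n. complex_ONB \<Omega> W m (q m)) \<longrightarrow>
        (\<forall>x y u v. complex_K_kernel q n (Complex x y) (Complex u v) =
                   complex_of_real (real_K_kernel p n (x, y) (u, v))))"
proof (intro conjI allI impI)
  note W = assms
  {
    fix Q :: "nat \<Rightarrow> complex \<Rightarrow> complex"
    have "basis_family n Q (complex_OP \<Omega> W n) \<longleftrightarrow> basis_family n P (real_OP \<Omega> W n)"
      if "\<forall>k\<le>n. P_of_Q n Q k = complexify P k" for P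
      using basis_family_cong[of n Q, OF Q_eq_Q_of_P[OF that]] basis_family_Q_of_P[OF W] by metis
    then show "basis_family n Q (complex_OP \<Omega> W n) \<and> conj_symmetric n Q \<longleftrightarrow>
        (\<exists>P. (\<forall>k\<le>n. P_of_Q n Q k = complexify P k) \<and> basis_family n P (real_OP \<Omega> W n))"
      using conj_symmetric_iff_real_P by metis
    have "complex_ONB \<Omega> W n Q \<longleftrightarrow> real_ONB \<Omega> W n (rescale_middle n P)"
      if "\<forall>k\<le>n. P_of_Q n Q k = complexify P k" for P
      using complex_ONB_cong[of n Q, OF Q_eq_Q_of_P[OF that]] complex_ONB_Q_of_P[OF W] by metis
    then show "complex_ONB \<Omega> W n Q \<and> conj_symmetric n Q \<longleftrightarrow>
        (\<exists>P. (\<forall>k\<le>n. P_of_Q n Q k = complexify P k) \<and> real_ONB \<Omega> W n (rescale_middle n P))"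
      using conj_symmetric_iff_real_P by metis
  }
  {
    fix P :: "nat \<Rightarrow> real \<times> real \<Rightarrow> real"
    show "basis_family n (Q_of_P n (complexify P)) (complex_OP \<Omega> W n) \<and>
        conj_symmetric n (Q_of_P n (complexify P)) \<longleftrightarrow> basis_family n P (real_OP \<Omega> W n)"
      by (simp add: basis_family_Q_of_P[OF W] conj_symmetric_Q_of_P)
    show "complex_ONB \<Omega> W n (Q_of_P n (complexify P)) \<longleftrightarrow> real_ONB \<Omega> W n (rescale_middle n P)"
      by (rule complex_ONB_Q_of_P[OF W])
  }
  {
    fix p :: "nat \<Rightarrow> nat \<Rightarrow> real \<times> real \<Rightarrow> real" and q :: "nat \<Rightarrow> nat \<Rightarrow> complex \<Rightarrow> complex"
      and x y u v :: real
    show "complex_P_kernel q n (Complex x y) (Complex u v) =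
        complex_of_real (real_P_kernel p n (x, y) (u, v))"
      if "real_ONB \<Omega> W n (p n)" "complex_ONB \<Omega> W n (q n)"
      using P_kernels_agree[where p = p and q = q and m = n, OF W that] .
    show "complex_K_kernel q n (Complex x y) (Complex u v) =
        complex_of_real (real_K_kernel p n (x, y) (u, v))"
      if "\<forall>m\<le>n. real_ONB \<Omega> W m (p m)" "\<forall>m\<le>n. complex_ONB \<Omega> W m (q m)"
      using P_kernels_agree[where p = p and q = q, OF W] that
      by (simp add: complex_K_kernel_def real_K_kernel_def)
  }
qed

end
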